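(* Let $G$ be a finite simple graph on $V=\{1,\dots,N\}$ with a proper edge colouring $c:E\to\{1,\dots,q\}$, let $R=\mathbb R^q$ with primitive idempotents $\varepsilon_\alpha$ and positive cone $R_+$, and let $w_{jk}=w_{kj}=\gamma_{jk}\varepsilon_{c(jk)}$ for $jk\in E$ with $\gamma_{jk}=\gamma_{kj}\geq0$ real, and $w_{jk}=0$ otherwise. Let $\mathsf D=\operatorname{diag}(d_1,\dots,d_N)$ with $d_j\in R_+$, and let $M=L^2B$ with $B=-2\mathsf D$ and $L=-\tfrac12\Delta_w$ (the pure-diffusion graph Fokker--Planck generator). Fix a channel $\alpha$. Then the effective transition graph of $M^{(\alpha)}$ (pairs $i\neq j$ with $M^{(\alpha)}_{ij}\neq0$ or $M_{ji}^{(\alpha)}\ne0$) is contained in the colour-$\alpha$ matching $\{ij\in E:c(ij)=\alpha\}$. Hence the continuous-time Markov chain with generator $M^{(\alpha)}$ started at a vertex $v$ remains in the connected component of $v$ in the colour-$\alpha$ matching, which contains at most two vertices. If a target set $T\subseteq V$ is disjoint from that component, then its hitting time $\tau_T$ satisfies $$\mathbb P_{v,\alpha}(\tau_T<\infty)=0,\qquad \mathbb E_{v,\alpha}[\tau_T]=\infty .$$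
   Context: $R=\mathbb R^q$ has componentwise multiplication and order; $R_+$ is the set of elements with all components nonnegative. $(\Delta_wf)_j=\sum_k w_{jk}(f_j-f_k)$ on $R^N$. The graph Fokker--Planck equation is $\dot P=-L(AP)+L^2(BP)=MP$; here $A=0$. Writing $M_{ij}=\sum_\alpha M_{ij}^{(\alpha)}\varepsilon_\alpha$, each $M^{(\alpha)}$ is a real $N\times N$ matrix with column convention: $M_{ij}^{(\alpha)}$ ($i\neq j$) is the transition rate from $j$ to $i$, and columns sum to zero. $\mathbb P_{v,\alpha}$, $\mathbb E_{v,\alpha}$ refer to the chain with generator $M^{(\alpha)}$ started at $v$; $\tau_T=\inf\{t\ge0:X_t\in T\}$ with $\inf\emptyset=\infty$. *)

theory Defs
  imports "HOL-Probability.Probability"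
begin

section \<open>Coloured graphs\<close>

text \<open>The vertex set is the finite type \<open>'n\<close>; an edge is a two-element set of vertices.\<close>

definition simple_graph :: "'n set set \<Rightarrow> bool" where
  "simple_graph E \<longleftrightarrow> finite E \<and> (\<forall>e\<in>E. card e = 2)"

definition proper_edge_colouring :: "'n set set \<Rightarrow> ('n set \<Rightarrow> 'q) \<Rightarrow> bool" where
  "proper_edge_colouring E c \<longleftrightarrow>
     (\<forall>e\<in>E. \<forall>f\<in>E. e \<noteq> f \<and> e \<inter> f \<noteq> {} \<longrightarrow> c e \<noteq> c f)"

definition colour_matching :: "'n set set \<Rightarrow> ('n set \<Rightarrow> 'q) \<Rightarrow> 'q \<Rightarrow> 'n set set" where
  "colour_matching E c \<alpha> = {e \<in> E. c e = \<alpha>}"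

definition graph_component :: "'n set set \<Rightarrow> 'n \<Rightarrow> 'n set" where
  "graph_component F v = {u. (v, u) \<in> {(a, b). {a, b} \<in> F}\<^sup>*}"

section \<open>The graph Laplacian over \<open>R = \<real>\<^sup>q\<close>\<close>

text \<open>\<open>R\<close> is the type \<open>real^'q\<close>, whose library multiplication and order are componentwise;
  \<open>R\<^sub>+\<close> is \<open>{x. 0 \<le> x}\<close>.\<close>

definition idem :: "'q::finite \<Rightarrow> real^'q" where
  "idem \<alpha> = axis \<alpha> 1"

definition graph_laplacian ::
    "('n::finite \<Rightarrow> 'n \<Rightarrow> real^'q) \<Rightarrow> (real^'q)^'n \<Rightarrow> (real^'q::finite)^'n" where
  "graph_laplacian w f = (\<chi> j. \<Sum>k\<in>UNIV. w j k * (f $ j - f $ k))"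

definition diag :: "'a::zero^'n \<Rightarrow> 'a^'n^'n" where
  "diag d = (\<chi> i j. if i = j then d $ i else 0)"

text \<open>The real matrices \<open>M\<^sup>(\<^sup>\<alpha>\<^sup>)\<close> determined by
  \<open>M\<^sub>i\<^sub>j = (\<Sum>\<alpha>. M\<^sup>(\<^sup>\<alpha>\<^sup>)\<^sub>i\<^sub>j \<epsilon>\<^sub>\<alpha>)\<close>; see \<open>channel_decomposition\<close> below.\<close>

definition channel :: "'q \<Rightarrow> (real^'q::finite)^'n^'n \<Rightarrow> real^'n^'n" where
  "channel \<alpha> M = (\<chi> i j. M $ i $ j $ \<alpha>)"

lemma channel_decomposition:
  "M $ i $ j = (\<Sum>\<alpha>\<in>UNIV. (channel \<alpha> M $ i $ j) *\<^sub>R idem \<alpha>)"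
  by (simp add: vec_eq_iff channel_def idem_def axis_def if_distrib[of "\<lambda>x. _ * x"] cong: if_cong)

definition effective_transition_graph :: "real^'n^'n \<Rightarrow> 'n set set" where
  "effective_transition_graph Q = {{i, j} | i j. i \<noteq> j \<and> (Q $ i $ j \<noteq> 0 \<or> Q $ j $ i \<noteq> 0)}"

section \<open>Continuous-time Markov chains\<close>

text \<open>Column convention throughout: \<open>Q $ i $ j\<close> is the rate of the transition from \<open>j\<close> to \<open>i\<close>.\<close>

definition rate_matrix :: "real^'n::finite^'n \<Rightarrow> bool" where
  "rate_matrix Q \<longleftrightarrow>
     (\<forall>i j. i \<noteq> j \<longrightarrow> 0 \<le> Q $ i $ j) \<and> (\<forall>j. (\<Sum>i\<in>UNIV. Q $ i $ j) = 0)"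

primrec matrix_pow :: "real^'n::finite^'n \<Rightarrow> nat \<Rightarrow> real^'n^'n" where
  "matrix_pow Q 0 = mat 1"
| "matrix_pow Q (Suc n) = Q ** matrix_pow Q n"

definition matrix_exp :: "real^'n::finite^'n \<Rightarrow> real^'n^'n" where
  "matrix_exp Q = (\<Sum>n. (1 / fact n) *\<^sub>R matrix_pow Q n)"

text \<open>A realisation, on some probability space, of the chain with generator \<open>Q\<close> started at \<open>v\<close>:
  a process with right-continuous paths (for the discrete topology on the states) whose
  finite-dimensional distributions are those of the transition semigroup \<open>exp (t Q)\<close>. The
  instance \<open>n = 0\<close> of the last clause says that the chain starts at \<open>v\<close> almost surely.\<close>

definition markov_chain ::
    "real^'n::finite^'n \<Rightarrow> 'n \<Rightarrow> 'w measure \<Rightarrow> (real \<Rightarrow> 'w \<Rightarrow> 'n) \<Rightarrow> bool" where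
  "markov_chain Q v \<Omega> X \<longleftrightarrow>
     prob_space \<Omega> \<and>
     (\<forall>t\<ge>0. X t \<in> measurable \<Omega> (count_space UNIV)) \<and>
     (\<forall>\<omega>\<in>space \<Omega>. \<forall>t\<ge>0. \<forall>\<^sub>F s in at_right t. X s \<omega> = X t \<omega>) \<and>
     (\<forall>(n::nat) (t::nat \<Rightarrow> real) (x::nat \<Rightarrow> 'n).
        t 0 = 0 \<and> (\<forall>k<n. t k \<le> t (Suc k)) \<longrightarrow>
        measure \<Omega> {\<omega> \<in> space \<Omega>. \<forall>k\<le>n. X (t k) \<omega> = x k} =
          (if x 0 = v
           then \<Prod>k<n. matrix_exp ((t (Suc k) - t k) *\<^sub>R Q) $ x (Suc k) $ x k
           else 0))"

definition hitting_time :: "(real \<Rightarrow> 'w \<Rightarrow> 'n) \<Rightarrow> 'n set \<Rightarrow> 'w \<Rightarrow> ennreal" where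
  "hitting_time X T \<omega> = Inf {ennreal t | t. 0 \<le> t \<and> X t \<omega> \<in> T}"

subsection \<open>Well-definedness\<close>

lemma matrix_pow_bound:
  "\<bar>matrix_pow Q k $ i $ j\<bar> \<le> (\<Sum>i\<in>UNIV. \<Sum>j\<in>UNIV. \<bar>Q $ i $ j\<bar>) ^ k"
proof (induction k arbitrary: i)
  case 0
  show ?case by (simp add: mat_def)
next
  case (Suc k)
  let ?K = "\<Sum>i\<in>UNIV. \<Sum>j\<in>UNIV. \<bar>Q $ i $ j\<bar>"
  have K: "0 \<le> ?K" by (intro sum_nonneg) auto
  have "\<bar>matrix_pow Q (Suc k) $ i $ j\<bar> \<le> (\<Sum>l\<in>UNIV. \<bar>Q $ i $ l\<bar> * \<bar>matrix_pow Q k $ l $ j\<bar>)"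
    by (simp add: matrix_matrix_mult_def sum_abs abs_mult[symmetric])
  also have "\<dots> \<le> (\<Sum>l\<in>UNIV. \<bar>Q $ i $ l\<bar> * ?K ^ k)"
    by (intro sum_mono mult_left_mono Suc.IH) auto
  also have "\<dots> = (\<Sum>l\<in>UNIV. \<bar>Q $ i $ l\<bar>) * ?K ^ k"
    by (simp add: sum_distrib_right)
  also have "\<dots> \<le> ?K * ?K ^ k"
    using K by (intro mult_right_mono member_le_sum[of i UNIV "\<lambda>i. \<Sum>l\<in>UNIV. \<bar>Q $ i $ l\<bar>"])
      (auto intro: sum_nonneg)
  finally show ?case by simp
qed

lemma summable_matrix_exp: "summable (\<lambda>n. (1 / fact n) *\<^sub>R matrix_pow Q n)"
  for Q :: "real^'n::finite^'n"
proof -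
  let ?K = "\<Sum>i\<in>UNIV. \<Sum>j\<in>UNIV. \<bar>Q $ i $ j\<bar>"
  let ?C = "real (CARD('n)) * real (CARD('n))"
  have bound: "norm (matrix_pow Q n) \<le> ?C * ?K ^ n" for n
  proof -
    have "norm (matrix_pow Q n) \<le> (\<Sum>i\<in>UNIV. norm (matrix_pow Q n $ i))"
      by (simp add: norm_vec_def L2_set_le_sum)
    also have "\<dots> \<le> (\<Sum>i\<in>UNIV. \<Sum>j\<in>UNIV. \<bar>matrix_pow Q n $ i $ j\<bar>)"
      by (intro sum_mono norm_le_l1_cart)
    also have "\<dots> \<le> (\<Sum>i\<in>(UNIV::'n set). \<Sum>j\<in>(UNIV::'n set). ?K ^ n)"
      by (intro sum_mono matrix_pow_bound)
    finally show ?thesis by simp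
  qed
  have "summable (\<lambda>n. ?C * (inverse (fact n) * ?K ^ n))"
    by (intro summable_mult summable_exp)
  then show ?thesis
  proof (rule summable_comparison_test')
    fix n :: nat
    show "norm ((1 / fact n) *\<^sub>R matrix_pow Q n) \<le> ?C * (inverse (fact n) * ?K ^ n)"
      using mult_left_mono[OF bound[of n], of "inverse (fact n)"]
      by (simp add: divide_inverse mult_ac)
  qed
qed

lemma hitting_time_measurable:
  assumes "markov_chain Q v \<Omega> X"
  shows "hitting_time X T \<in> borel_measurable \<Omega>"
proof -
  have meas: "X t \<in> measurable \<Omega> (count_space UNIV)" if "t \<ge> 0" for t
    using assms that by (auto simp: markov_chain_def)
  have rc: "\<forall>\<^sub>F s in at_right t. X s \<omega> = X t \<omega>" if "\<omega> \<in> space \<Omega>" "t \<ge> 0" for \<omega> t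
    using assms that by (auto simp: markov_chain_def)
  define D where "D = {t \<in> \<rat>. (0::real) \<le> t}"
  have D: "countable D"
    unfolding D_def by (rule countable_subset[OF _ countable_rat]) auto
  have eq: "(hitting_time X T \<omega> < a) \<longleftrightarrow> (\<exists>t\<in>D. ennreal t < a \<and> X t \<omega> \<in> T)"
    if \<omega>: "\<omega> \<in> space \<Omega>" for \<omega> a
  proof
    assume "hitting_time X T \<omega> < a"
    then obtain t where t: "0 \<le> t" "X t \<omega> \<in> T" "ennreal t < a"
      unfolding hitting_time_def Inf_less_iff by auto
    have "((\<lambda>s. ennreal s) \<longlongrightarrow> ennreal t) (at_right t)"
      by (intro tendsto_intros)
    then have "\<forall>\<^sub>F s in at_right t. ennreal s < a"
      using t(3) by (rule order_tendstoD)
    then have "\<forall>\<^sub>F s in at_right t. ennreal s < a \<and> X s \<omega> = X t \<omega>"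
      using rc[OF \<omega> t(1)] by (rule eventually_conj)
    then obtain b where b: "b > t" "\<And>s. t < s \<Longrightarrow> s < b \<Longrightarrow> ennreal s < a \<and> X s \<omega> = X t \<omega>"
      unfolding eventually_at_right_field by auto
    obtain s where "s \<in> \<rat>" "t < s" "s < b"
      using Rats_dense_in_real[OF b(1)] by auto
    then show "\<exists>t\<in>D. ennreal t < a \<and> X t \<omega> \<in> T"
      using b(2)[of s] t by (intro bexI[of _ s]) (auto simp: D_def)
  next
    assume "\<exists>t\<in>D. ennreal t < a \<and> X t \<omega> \<in> T"
    then show "hitting_time X T \<omega> < a"
      unfolding hitting_time_def Inf_less_iff D_def by auto
  qed
  show ?thesis
  proof (rule borel_measurableI_less)
    fix a :: ennreal
    have "{\<omega> \<in> space \<Omega>. hitting_time X T \<omega> < a} =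
        (\<Union>t\<in>{t\<in>D. ennreal t < a}. X t -` T \<inter> space \<Omega>)"
      using eq by blast
    also have "\<dots> \<in> sets \<Omega>"
    proof (rule sets.countable_UN')
      show "countable {t \<in> D. ennreal t < a}"
        using D by (rule countable_subset[rotated]) auto
      show "(\<lambda>t. X t -` T \<inter> space \<Omega>) ` {t \<in> D. ennreal t < a} \<subseteq> sets \<Omega>"
        using meas by (auto simp: D_def intro: measurable_sets)
    qed
    finally show "{\<omega> \<in> space \<Omega>. hitting_time X T \<omega> < a} \<in> sets \<Omega>" .
  qed
qed

end

theory Submission
  imports Defs
begin

text \<open>In channel \<open>\<alpha>\<close> the Laplacian only sees the colour-\<open>\<alpha>\<close> edges, which form a matching.
  A matching contains no path of length two, so squaring the Laplacian creates no new transitions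
  and the signs of the off-diagonal entries are forced. The powers of the generator, hence its
  exponential, then preserve the components; right continuity carries this from
  rational times to all times.\<close>

section \<open>Matchings\<close>

definition matching :: "'n set set \<Rightarrow> bool" where
  "matching F \<longleftrightarrow> (\<forall>e\<in>F. \<forall>f\<in>F. e \<inter> f \<noteq> {} \<longrightarrow> e = f)"

lemma matching_colour_matching:
  "proper_edge_colouring E c \<Longrightarrow> matching (colour_matching E c \<alpha>)"
  unfolding proper_edge_colouring_def colour_matching_def matching_def by blast

text \<open>Both edges contain \<open>k\<close>, so in a matching they coincide. This is the form in
  which the matching property enters below: no vertex has two distinct partners.\<close>

lemma matching_neighbour_unique:
  assumes "matching F" "{k, i} \<in> F" "{k, j} \<in> F"
  shows "i = j"
proof -
  have "{k, i} \<inter> {k, j} \<noteq> {}" by simp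
  with assms have "{k, i} = {k, j}"
    unfolding matching_def by metis
  then show ?thesis by (auto simp: doubleton_eq_iff)
qed

lemma graph_component_self: "v \<in> graph_component F v"
  by (simp add: graph_component_def)

lemma graph_component_step:
  assumes "u \<in> graph_component F v" "{u, x} \<in> F"
  shows "x \<in> graph_component F v"
  using assms unfolding graph_component_def by (auto intro: rtrancl_into_rtrancl)

text \<open>Induction along a walk from \<open>v\<close>: from a partner \<open>y\<close> of
  \<open>v\<close> the only edge leads back, so the next vertex is \<open>v\<close> again.\<close>

lemma graph_component_matching:
  assumes "matching F"
  shows "graph_component F v \<subseteq> insert v {u. {v, u} \<in> F}"
proof
  fix u assume "u \<in> graph_component F v"
  then have "(v, u) \<in> {(a, b). {a, b} \<in> F}\<^sup>*"
    by (simp add: graph_component_def)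
  then show "u \<in> insert v {u. {v, u} \<in> F}"
  proof (induction rule: rtrancl_induct)
    case (step y z)
    then show ?case
      using matching_neighbour_unique[OF assms, of y v z] by (auto simp: insert_commute)
  qed simp
qed

lemma card_graph_component_matching:
  assumes "matching F"
  shows "card (graph_component F v) \<le> 2"
proof -
  \<comment> \<open>If \<open>v\<close> has a partner, it is \<open>u\<close>; otherwise any
    \<open>u\<close> serves.\<close>
  have "\<exists>u. graph_component F v \<subseteq> {v, u}"
    using graph_component_matching[OF assms, of v] matching_neighbour_unique[OF assms, of v]
    by blast
  then obtain u where "graph_component F v \<subseteq> {v, u}" ..
  then have "card (graph_component F v) \<le> card {v, u}"
    by (intro card_mono) auto
  also have "\<dots> \<le> 2"
    by (simp add: card_insert_if)
  finally show ?thesis .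
qed

section \<open>The generator in one channel\<close>

text \<open>Degree matrix minus weight matrix. A loop weight \<open>a i i\<close> is counted in the
  row sum and subtracted again, matching the vanishing term \<open>k = j\<close> of the
  operator.\<close>

definition laplacian_matrix :: "('n::finite \<Rightarrow> 'n \<Rightarrow> real) \<Rightarrow> real^'n^'n" where
  "laplacian_matrix a = (\<chi> i j. (if i = j then \<Sum>k\<in>UNIV. a i k else 0) - a i j)"

text \<open>Multiplication in \<open>real^'q\<close> is componentwise, so taking one component is a
  ring homomorphism and matrix products over R split channel by channel.\<close>

lemma channel_mult: "channel \<alpha> (P ** Q) = channel \<alpha> P ** channel \<alpha> Q"
  by (simp add: channel_def matrix_matrix_mult_def vec_eq_iff)

lemma channel_scaleR: "channel \<alpha> (r *\<^sub>R P) = r *\<^sub>R channel \<alpha> P"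
  by (simp add: channel_def vec_eq_iff)

lemma channel_diag: "channel \<alpha> (diag d) = diag (\<chi> j. d $ j $ \<alpha>)"
  by (simp add: channel_def diag_def vec_eq_iff)

text \<open>Column \<open>j\<close> is the Laplacian of \<open>axis j 1\<close>, where
  \<open>1\<close> has all components 1, so every channel sees the real indicator of
  \<open>j\<close>.\<close>

lemma channel_graph_laplacian:
  fixes w :: "'n::finite \<Rightarrow> 'n \<Rightarrow> real^'q::finite"
  shows "channel \<alpha> (matrix (graph_laplacian w)) = laplacian_matrix (\<lambda>j k. w j k $ \<alpha>)"
proof -
  have "(\<Sum>k\<in>UNIV. w i k $ \<alpha> * ((axis j 1 :: (real^'q)^'n) $ i $ \<alpha> - axis j 1 $ k $ \<alpha>)) =
      (if i = j then \<Sum>k\<in>UNIV. w i k $ \<alpha> else 0) - w i j $ \<alpha>" for i j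
  proof -
    have "(\<Sum>k\<in>UNIV. w i k $ \<alpha> * ((axis j 1 :: (real^'q)^'n) $ i $ \<alpha> - axis j 1 $ k $ \<alpha>)) =
        (\<Sum>k\<in>UNIV. (if i = j then w i k $ \<alpha> else 0) - (if k = j then w i k $ \<alpha> else 0))"
      by (intro sum.cong) (auto simp: axis_def)
    then show ?thesis by (simp add: sum_subtractf)
  qed
  then show ?thesis
    by (simp add: channel_def matrix_def graph_laplacian_def laplacian_matrix_def vec_eq_iff)
qed

lemma matrix_mult_diag:
  fixes A :: "real^'n::finite^'n"
  shows "(A ** diag d) $ i $ j = A $ i $ j * d $ j"
  by (simp add: matrix_matrix_mult_def diag_def if_distrib[of "\<lambda>x. _ * x"] cong: if_cong)

section \<open>The squared Laplacian of a weighted matching\<close>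

locale weighted_matching =
  fixes F :: "'n::finite set set" and a :: "'n \<Rightarrow> 'n \<Rightarrow> real"
  assumes matching: "matching F"
    and weight_sym: "a i j = a j i"
    and weight_nonneg: "0 \<le> a i j"
    and weight_support: "a i j \<noteq> 0 \<Longrightarrow> {i, j} \<in> F"
begin

abbreviation A :: "real^'n^'n" where
  "A \<equiv> laplacian_matrix a"

lemma off_diagonal: "i \<noteq> j \<Longrightarrow> A $ i $ j = - a i j"
  by (simp add: laplacian_matrix_def)

lemma diagonal_nonneg: "0 \<le> A $ i $ i"
  using member_le_sum[of i UNIV "a i"] weight_nonneg by (simp add: laplacian_matrix_def)

text \<open>Symmetry of the weights turns the column sum into a row sum, which cancels the
  degree.\<close>

lemma column_sum: "(\<Sum>i\<in>UNIV. A $ i $ j) = 0"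
proof -
  have "(\<Sum>i\<in>UNIV. a i j) = (\<Sum>k\<in>UNIV. a j k)"
    by (simp add: weight_sym)
  then show ?thesis
    by (simp add: laplacian_matrix_def sum_subtractf)
qed

text \<open>A nonzero product would give \<open>k\<close> two distinct partners \<open>i\<close> and
  \<open>j\<close>.\<close>

lemma path_two_zero:
  assumes "i \<noteq> j" "k \<noteq> i" "k \<noteq> j"
  shows "A $ i $ k * A $ k $ j = 0"
proof (rule ccontr)
  assume "A $ i $ k * A $ k $ j \<noteq> 0"
  then have "{k, i} \<in> F" "{k, j} \<in> F"
    using assms weight_support[of i k] weight_support[of k j]
    by (auto simp: off_diagonal insert_commute)
  then show False
    using matching_neighbour_unique[OF matching] assms(1) by blast
qed

text \<open>In the sum over the middle vertex \<open>k\<close>, the terms \<open>k = i\<close> and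
  \<open>k = j\<close> pair a nonnegative diagonal entry with a nonpositive off-diagonal one. All
  other terms, which in a general graph could be positive, vanish by
  \<open>path_two_zero\<close>.\<close>

lemma square_off_diagonal_nonpos:
  assumes "i \<noteq> j"
  shows "(A ** A) $ i $ j \<le> 0"
proof -
  have "A $ i $ k * A $ k $ j \<le> 0" for k
    using assms path_two_zero[of i j k] diagonal_nonneg weight_nonneg
    by (cases "k = i \<or> k = j") (auto simp: off_diagonal intro: mult_nonneg_nonneg)
  then show ?thesis
    by (simp add: matrix_matrix_mult_def sum_nonpos)
qed

lemma square_off_diagonal_support:
  assumes "i \<noteq> j" "(A ** A) $ i $ j \<noteq> 0"
  shows "{i, j} \<in> F"
proof (rule ccontr)
  assume "{i, j} \<notin> F"
  then have "A $ i $ j = 0"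
    using assms(1) weight_support[of i j] by (auto simp: off_diagonal)
  \<comment> \<open>For \<open>k = i\<close> or \<open>k = j\<close> the factor
    \<open>A $ i $ j\<close> itself occurs.\<close>
  then have "A $ i $ k * A $ k $ j = 0" for k
    using assms(1) path_two_zero[of i j k] by (cases "k = i \<or> k = j") auto
  then have "(A ** A) $ i $ j = 0"
    by (simp only: matrix_matrix_mult_def vec_lambda_beta sum.neutral_const)
  then show False
    using assms(2) by contradiction
qed

text \<open>The all-ones row vector already annihilates the left factor.\<close>

lemma square_column_sum: "(\<Sum>i\<in>UNIV. (A ** A) $ i $ j) = 0"
proof -
  have "(\<Sum>i\<in>UNIV. (A ** A) $ i $ j) = (\<Sum>k\<in>UNIV. \<Sum>i\<in>UNIV. A $ i $ k * A $ k $ j)"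
    unfolding matrix_matrix_mult_def vec_lambda_beta by (rule sum.swap)
  also have "\<dots> = 0"
    by (simp add: sum_distrib_right[symmetric] column_sum)
  finally show ?thesis .
qed

context
  fixes d :: "real^'n" and Q :: "real^'n^'n"
  assumes d: "\<And>j. 0 \<le> d $ j"
    and Q: "\<And>i j. Q $ i $ j = - (1 / 2) * (A ** A) $ i $ j * d $ j"
begin

text \<open>The factor -1/2 reverses the sign of the off-diagonal entries of the square, and
  \<open>d\<close> only rescales whole columns by nonnegative numbers.\<close>

lemma rate_matrix_square: "rate_matrix Q"
  unfolding rate_matrix_def
proof (intro conjI allI impI)
  fix i j :: 'n assume "i \<noteq> j"
  then show "0 \<le> Q $ i $ j"
    using square_off_diagonal_nonpos[of i j] d[of j] by (simp add: Q mult_nonpos_nonneg)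
next
  fix j
  have "(\<Sum>i\<in>UNIV. Q $ i $ j) = - (1 / 2) * (\<Sum>i\<in>UNIV. (A ** A) $ i $ j) * d $ j"
    by (simp only: Q sum_distrib_left sum_distrib_right)
  then show "(\<Sum>i\<in>UNIV. Q $ i $ j) = 0"
    by (simp add: square_column_sum)
qed

lemma effective_transition_graph_square: "effective_transition_graph Q \<subseteq> F"
proof
  fix e assume "e \<in> effective_transition_graph Q"
  then obtain i j where e: "e = {i, j}" "i \<noteq> j" and "Q $ i $ j \<noteq> 0 \<or> Q $ j $ i \<noteq> 0"
    by (auto simp: effective_transition_graph_def)
  then have "(A ** A) $ i $ j \<noteq> 0 \<or> (A ** A) $ j $ i \<noteq> 0"
    by (auto simp: Q)
  then show "e \<in> F"
    using e square_off_diagonal_support[of i j] square_off_diagonal_support[of j i]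
    by (auto simp: insert_commute)
qed

end

end

section \<open>Chains in a closed set of states\<close>

text \<open>In the column convention \<open>y\<close> is the source and \<open>x\<close> the target,
  so no transition leaves \<open>C\<close>.\<close>

definition closed_states :: "real^'n^'n \<Rightarrow> 'n set \<Rightarrow> bool" where
  "closed_states Q C \<longleftrightarrow> (\<forall>x. \<forall>y\<in>C. Q $ x $ y \<noteq> 0 \<longrightarrow> x \<in> C)"

lemma closed_states_graph_component:
  assumes "effective_transition_graph Q \<subseteq> F"
  shows "closed_states Q (graph_component F v)"
  unfolding closed_states_def
proof (intro allI ballI impI)
  fix x y assume y: "y \<in> graph_component F v" and xy: "Q $ x $ y \<noteq> 0"
  show "x \<in> graph_component F v"
  proof (cases "x = y")
    case False
    then have "{y, x} \<in> effective_transition_graph Q"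
      using xy unfolding effective_transition_graph_def by blast
    then show ?thesis
      by (rule graph_component_step[OF y subsetD[OF assms]])
  qed (use y in simp)
qed

text \<open>In the product over an intermediate state \<open>k\<close>, the first factor vanishes if
  \<open>k\<close> lies in \<open>C\<close>, and the second vanishes by induction otherwise.\<close>

lemma matrix_pow_closed_states:
  assumes "closed_states Q C" "v \<in> C" "x \<notin> C"
  shows "matrix_pow Q n $ x $ v = 0"
  using assms(3)
proof (induction n arbitrary: x)
  case 0
  then show ?case using assms(2) by (auto simp: mat_def)
next
  case (Suc n)
  have "Q $ x $ k * matrix_pow Q n $ k $ v = 0" for k
    using Suc assms(1) by (cases "k \<in> C") (auto simp: closed_states_def)
  then show ?case
    by (simp only: matrix_pow.simps matrix_matrix_mult_def vec_lambda_beta sum.neutral_const)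
qed

text \<open>Reading off an entry is bounded and linear, so it passes through the convergent
  series.\<close>

lemma matrix_exp_nth:
  "matrix_exp Q $ x $ y = (\<Sum>n. (1 / fact n) * matrix_pow Q n $ x $ y)"
proof -
  have "bounded_linear (\<lambda>P :: real^'a^'a. P $ x $ y)"
    by (intro bounded_linear_compose[OF bounded_linear_vec_nth bounded_linear_vec_nth])
  from bounded_linear.suminf[OF this summable_matrix_exp[of Q]] show ?thesis
    by (simp add: matrix_exp_def)
qed

lemma matrix_exp_closed_states:
  assumes "closed_states Q C" "v \<in> C" "x \<notin> C"
  shows "matrix_exp (t *\<^sub>R Q) $ x $ v = 0"
proof -
  have "closed_states (t *\<^sub>R Q) C"
    using assms(1) by (simp add: closed_states_def)
  then show ?thesis
    using assms(2,3) by (simp add: matrix_exp_nth matrix_pow_closed_states)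
qed

section \<open>From the transition semigroup to sample paths\<close>

context
  fixes Q :: "real^'n::finite^'n" and C :: "'n set" and v :: 'n
    and \<Omega> :: "'w measure" and X :: "real \<Rightarrow> 'w \<Rightarrow> 'n"
  assumes closed: "closed_states Q C" and v: "v \<in> C"
    and chain: "markov_chain Q v \<Omega> X"
begin

lemma markov_chain_closed_states_at:
  assumes "0 \<le> t"
  shows "AE \<omega> in \<Omega>. X t \<omega> \<in> C"
proof -
  interpret prob_space \<Omega>
    using chain by (simp add: markov_chain_def)
  have meas: "X s \<in> measurable \<Omega> (count_space UNIV)" if "0 \<le> s" for s
    using chain that by (simp add: markov_chain_def)
  note [measurable] = meas[of 0, simplified] meas[OF assms]
  have fdd: "measure \<Omega> {\<omega> \<in> space \<Omega>. \<forall>k\<le>n. X (s k) \<omega> = z k} =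
      (if z 0 = v then \<Prod>k<n. matrix_exp ((s (Suc k) - s k) *\<^sub>R Q) $ z (Suc k) $ z k else 0)"
    if "s 0 = 0" "\<And>k. k < n \<Longrightarrow> s k \<le> s (Suc k)" for s n z
    using chain that unfolding markov_chain_def by blast
  \<comment> \<open>All initial states \<open>y\<close> are treated, since the start at
    \<open>v\<close> holds only almost surely. The clause for the two times 0 and \<open>t\<close>
    (\<open>n = 1\<close>) gives an entry of the exponential if \<open>y = v\<close> and 0
    otherwise.\<close>
  have "AE \<omega> in \<Omega>. \<not> (X 0 \<omega> = y \<and> X t \<omega> = x)" if "x \<notin> C" for x y
  proof -
    define s where "s k = (if k = 0 then 0 else t)" for k :: nat
    define z where "z k = (if k = 0 then y else x)" for k :: nat
    have "measure \<Omega> {\<omega> \<in> space \<Omega>. \<forall>k\<le>1. X (s k) \<omega> = z k} =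
        (if z 0 = v then \<Prod>k<1. matrix_exp ((s (Suc k) - s k) *\<^sub>R Q) $ z (Suc k) $ z k else 0)"
      by (rule fdd) (simp_all add: s_def assms)
    also have "\<dots> = 0"
      using matrix_exp_closed_states[OF closed v that] by (simp add: s_def z_def)
    also have "{\<omega> \<in> space \<Omega>. \<forall>k\<le>1. X (s k) \<omega> = z k} = {\<omega> \<in> space \<Omega>. X 0 \<omega> = y \<and> X t \<omega> = x}"
      by (auto simp: le_Suc_eq s_def z_def)
    finally have "prob {\<omega> \<in> space \<Omega>. X 0 \<omega> = y \<and> X t \<omega> = x} = 0" .
    moreover have "{\<omega> \<in> space \<Omega>. X 0 \<omega> = y \<and> X t \<omega> = x} \<in> events"
      by measurable
    ultimately show ?thesis
      using prob_eq_0[of "{\<omega> \<in> space \<Omega>. X 0 \<omega> = y \<and> X t \<omega> = x}"] by (auto elim: AE_mp)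
  qed
  then have "AE \<omega> in \<Omega>. x \<notin> C \<longrightarrow> \<not> (X 0 \<omega> = y \<and> X t \<omega> = x)" for x y
    by (cases "x \<in> C") simp_all
  \<comment> \<open>There are only finitely many pairs of states, so the exceptional null sets can
    be united.\<close>
  then have "AE \<omega> in \<Omega>. \<forall>x. \<forall>y. x \<notin> C \<longrightarrow> \<not> (X 0 \<omega> = y \<and> X t \<omega> = x)"
    unfolding AE_all_countable by (intro allI)
  then show ?thesis
    by (rule AE_mp) auto
qed

lemma markov_chain_closed_states:
  "AE \<omega> in \<Omega>. \<forall>t\<ge>0. X t \<omega> \<in> C"
proof -
  have "AE \<omega> in \<Omega>. \<forall>t\<in>{t \<in> \<rat>. 0 \<le> t}. X t \<omega> \<in> C"
    by (subst AE_ball_countable)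
      (auto intro: countable_subset[OF _ countable_rat] markov_chain_closed_states_at)
  then show ?thesis
  proof (rule AE_mp, intro AE_I2 impI allI)
    fix \<omega> and t :: real
    assume \<omega>: "\<omega> \<in> space \<Omega>" and rat: "\<forall>t\<in>{t \<in> \<rat>. 0 \<le> t}. X t \<omega> \<in> C" and t: "0 \<le> t"
    \<comment> \<open>The state at \<open>t\<close> persists on some interval to the right, which
      contains a rational time.\<close>
    have "\<forall>\<^sub>F s in at_right t. X s \<omega> = X t \<omega>"
      using chain \<omega> t by (simp add: markov_chain_def)
    then obtain b where b: "t < b" "\<And>s. t < s \<Longrightarrow> s < b \<Longrightarrow> X s \<omega> = X t \<omega>"
      unfolding eventually_at_right_field by auto
    obtain s where "s \<in> \<rat>" "t < s" "s < b"
      using Rats_dense_in_real[OF b(1)] by auto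
    then show "X t \<omega> \<in> C"
      using b(2)[of s] rat t by auto
  qed
qed

text \<open>Along a path inside \<open>C\<close> no time hits \<open>T\<close>, and the infimum of
  the empty set in \<open>ennreal\<close> is infinity.\<close>

lemma hitting_time_outside_closed_states:
  assumes "T \<inter> C = {}"
  shows "AE \<omega> in \<Omega>. hitting_time X T \<omega> = \<infinity>"
  using markov_chain_closed_states
proof (rule AE_mp, intro AE_I2 impI)
  fix \<omega> assume "\<forall>t\<ge>0. X t \<omega> \<in> C"
  then show "hitting_time X T \<omega> = \<infinity>"
    using assms by (auto simp: hitting_time_def)
qed

lemma measure_hitting_time_finite:
  assumes "T \<inter> C = {}"
  shows "measure \<Omega> {\<omega> \<in> space \<Omega>. hitting_time X T \<omega> < \<infinity>} = 0"
proof -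
  interpret prob_space \<Omega>
    using chain by (simp add: markov_chain_def)
  show ?thesis
    using hitting_time_outside_closed_states[OF assms] by (intro prob_eq_0_AE) (auto simp: less_top)
qed

lemma expectation_hitting_time:
  assumes "T \<inter> C = {}"
  shows "(\<integral>\<^sup>+ \<omega>. hitting_time X T \<omega> \<partial>\<Omega>) = \<infinity>"
proof -
  interpret prob_space \<Omega>
    using chain by (simp add: markov_chain_def)
  have "(\<integral>\<^sup>+ \<omega>. hitting_time X T \<omega> \<partial>\<Omega>) = (\<integral>\<^sup>+ \<omega>. \<infinity> \<partial>\<Omega>)"
    by (rule nn_integral_cong_AE[OF hitting_time_outside_closed_states[OF assms]])
  \<comment> \<open>The constant infinity is integrated against total mass 1.\<close>
  then show ?thesis
    by (simp add: emeasure_space_1)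
qed

end

theorem theorem4p4:
  fixes E :: "'n::finite set set"
    and c :: "'n set \<Rightarrow> 'q::finite"
    and \<gamma> :: "'n \<Rightarrow> 'n \<Rightarrow> real"
    and w :: "'n \<Rightarrow> 'n \<Rightarrow> real^'q"
    and d :: "(real^'q)^'n"
    and L B M :: "(real^'q)^'n^'n"
    and \<alpha> :: 'q
  assumes graph: "simple_graph E"
    and colouring: "proper_edge_colouring E c"
    and gamma: "\<And>j k. {j, k} \<in> E \<Longrightarrow> \<gamma> j k = \<gamma> k j \<and> 0 \<le> \<gamma> j k"
    and w: "\<And>j k. w j k = (if {j, k} \<in> E then \<gamma> j k *\<^sub>R idem (c {j, k}) else 0)"
    and d: "\<And>j. 0 \<le> d $ j"
    and L: "L = (- 1 / 2) *\<^sub>R matrix (graph_laplacian w)"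
    and B: "B = (- 2) *\<^sub>R diag d"
    and M: "M = L ** L ** B"
  shows "rate_matrix (channel \<alpha> M) \<and>
    effective_transition_graph (channel \<alpha> M) \<subseteq> colour_matching E c \<alpha> \<and>
    (\<forall>v. card (graph_component (colour_matching E c \<alpha>) v) \<le> 2 \<and>
      (\<forall>(\<Omega> :: 'w measure) X. markov_chain (channel \<alpha> M) v \<Omega> X \<longrightarrow>
        (AE \<omega> in \<Omega>. \<forall>t\<ge>0. X t \<omega> \<in> graph_component (colour_matching E c \<alpha>) v) \<and>
        (\<forall>T. T \<inter> graph_component (colour_matching E c \<alpha>) v = {} \<longrightarrow>
          measure \<Omega> {\<omega> \<in> space \<Omega>. hitting_time X T \<omega> < \<infinity>} = 0 \<and>
          (\<integral>\<^sup>+ \<omega>. hitting_time X T \<omega> \<partial>\<Omega>) = \<infinity>)))"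
proof -
  define F where "F = colour_matching E c \<alpha>"
  define a where "a = (\<lambda>j k. w j k $ \<alpha>)"
  \<comment> \<open>Component \<alpha> of \<open>idem (c {j, k})\<close> is 1 exactly when the edge
    has colour \<alpha>, and 0 otherwise.\<close>
  have a: "a j k = (if {j, k} \<in> F then \<gamma> j k else 0)" for j k
    by (auto simp: a_def w F_def colour_matching_def idem_def axis_def)
  have F_edge: "{j, k} \<in> E" if "{j, k} \<in> F" for j k
    using that by (simp add: F_def colour_matching_def)
  have matching: "matching F"
    unfolding F_def by (rule matching_colour_matching[OF colouring])
  \<comment> \<open>Symmetry and sign of \<open>\<gamma>\<close> are known only on edges; off
    \<open>F\<close> the weight \<open>a\<close> is 0.\<close>
  interpret weighted_matching F a
    using matching gamma F_edge by unfold_locales (auto simp: a insert_commute split: if_splits)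
  define Q where "Q = channel \<alpha> M"
  have "Q = (- 1 / 2) *\<^sub>R A ** ((- 1 / 2) *\<^sub>R A) ** ((- 2) *\<^sub>R diag (\<chi> j. d $ j $ \<alpha>))"
    by (simp only: Q_def M L B channel_mult channel_scaleR channel_diag channel_graph_laplacian a_def)
  \<comment> \<open>The scalars combine as (-1/2) * (-1/2) * (-2) = -1/2.\<close>
  then have "Q = (- 1 / 2) *\<^sub>R ((A ** A) ** diag (\<chi> j. d $ j $ \<alpha>))"
    by (simp only: scalar_matrix_assoc[symmetric] matrix_scalar_ac scaleR_scaleR) simp
  then have Q: "Q $ i $ j = - (1 / 2) * (A ** A) $ i $ j * (\<chi> j. d $ j $ \<alpha>) $ j" for i j
    by (simp add: matrix_mult_diag)
  have d\<alpha>: "0 \<le> (\<chi> j. d $ j $ \<alpha>) $ j" for j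
    using d[of j] by (simp add: less_eq_vec_def)
  have "effective_transition_graph Q \<subseteq> F"
    using d\<alpha> Q by (rule effective_transition_graph_square)
  moreover from this have closed: "closed_states Q (graph_component F v)" for v
    by (rule closed_states_graph_component)
  moreover have "rate_matrix Q"
    using d\<alpha> Q by (rule rate_matrix_square)
  ultimately show ?thesis
    unfolding Q_def[symmetric] F_def[symmetric]
    by (intro conjI allI impI card_graph_component_matching[OF matching]
        markov_chain_closed_states[OF closed graph_component_self]
        measure_hitting_time_finite[OF closed graph_component_self]
        expectation_hitting_time[OF closed graph_component_self])
qed

end
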